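(* Let $f:\mathbb{R}^d\to\mathbb{R}$ be $\rho$-weakly convex ($\rho\ge0$) with bounded sublevel sets and nonempty set of minimizers. Let $0<\lambda<1/\rho$ and let $f_\lambda$ be the Moreau envelope of $f$. Let $x^0\in\mathbb{R}^d$ and let the iterates $\{x^k\}_{k\ge0}$ be generated by the subgradient method $x^{k+1}=x^k-\alpha_kg(x^k)$ with $g(x^k)\in\partial f(x^k)$ and step sizes $$\alpha_k=\frac{\beta_k}{\|g(x^k)\|}\quad\text{with}\quad\beta_k>0,\quad\sum_{k=0}^\infty\beta_k=\infty,\quad\text{and}\quad\sum_{k=0}^\infty\beta_k^2\le\mathfrak{b}<\infty.$$ Then the trajectory $\{x^k\}$ lies in the bounded sublevel set $\mathcal{D}:=\{x\in\mathbb{R}^d:f_\lambda(x)\le f_\lambda(x^0)+\frac{\mathfrak{b}}{2\lambda}\}$. Consequently, $\lim_{k\to\infty}\|\nabla f_\lambda(x^k)\|=0$, namely, every accumulation point of $\{x^k\}$ is a stationary point of the problem $\min_{x\in\mathbb{R}^d}f(x)$.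
   Context: $\|\cdot\|$ is the Euclidean norm. $f$ is $\rho$-weakly convex if $\phi(x)=f(x)+\frac{\rho}{2}\|x\|^2$ is convex; its subdifferential is $\partial f(x)=\partial\phi(x)-\rho x$, with $\partial\phi$ the convex subdifferential, and $g(x^k)$ is an arbitrarily chosen element of $\partial f(x^k)$. If $g(x^k)=0$, then $x^{k+1}=x^k$ regardless of the value assigned to $\alpha_k$. A point $x$ is stationary if $0\in\partial f(x)$. $f$ has bounded sublevel sets if $\{x\in\mathbb{R}^d:f(x)\le s\}$ is bounded for every $s\in\mathbb{R}$. The Moreau envelope is $f_\lambda(x)=\min_{y\in\mathbb{R}^d}\{f(y)+\frac1{2\lambda}\|y-x\|^2\}$; for $\lambda<1/\rho$ (with $1/0=+\infty$) it is differentiable. $f$ is not assumed globally Lipschitz. *)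

theory Defs
  imports "HOL-Analysis.Analysis"
begin

definition weakly_convex :: "real \<Rightarrow> ('a::real_inner \<Rightarrow> real) \<Rightarrow> bool" where
  "weakly_convex \<rho> f \<longleftrightarrow> convex_on UNIV (\<lambda>x. f x + \<rho> / 2 * (norm x)\<^sup>2)"

definition convex_subdifferential :: "('a::real_inner \<Rightarrow> real) \<Rightarrow> 'a \<Rightarrow> 'a set" where
  "convex_subdifferential \<phi> x = {v. \<forall>y. \<phi> y \<ge> \<phi> x + v \<bullet> (y - x)}"

definition weak_subdifferential :: "real \<Rightarrow> ('a::real_inner \<Rightarrow> real) \<Rightarrow> 'a \<Rightarrow> 'a set" where
  "weak_subdifferential \<rho> f x =
     (\<lambda>v. v - \<rho> *\<^sub>R x) ` convex_subdifferential (\<lambda>y. f y + \<rho> / 2 * (norm y)\<^sup>2) x"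

definition stationary_point :: "real \<Rightarrow> ('a::real_inner \<Rightarrow> real) \<Rightarrow> 'a \<Rightarrow> bool" where
  "stationary_point \<rho> f x \<longleftrightarrow> 0 \<in> weak_subdifferential \<rho> f x"

definition bounded_sublevel_sets :: "('a::real_normed_vector \<Rightarrow> real) \<Rightarrow> bool" where
  "bounded_sublevel_sets f \<longleftrightarrow> (\<forall>s. bounded {x. f x \<le> s})"

(* The infimum is a minimum for f weakly convex and bounded below: see moreau_envelope_attained. *)
definition moreau_envelope :: "real \<Rightarrow> ('a::real_normed_vector \<Rightarrow> real) \<Rightarrow> 'a \<Rightarrow> real" where
  "moreau_envelope lam f x = (INF y. f y + 1 / (2 * lam) * (norm (y - x))\<^sup>2)"

(* Unspecified where f is not differentiable; moreau_envelope_differentiable excludes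
   this for envelopes of weakly convex functions with 0 < lam < 1 / rho that are bounded below. *)
definition gradient :: "('a::real_inner \<Rightarrow> real) \<Rightarrow> 'a \<Rightarrow> 'a" where
  "gradient f x = (THE D. GDERIV f x :> D)"

lemma gradient_eqI:
  assumes "GDERIV f x :> D"
  shows "gradient f x = D"
  unfolding gradient_def
proof (rule the_equality)
  show "GDERIV f x :> D" by fact
  fix E assume "GDERIV f x :> E"
  then have "(\<lambda>h. h \<bullet> E) = (\<lambda>h. h \<bullet> D)"
    using assms unfolding gderiv_def by (rule has_derivative_unique)
  then show "E = D"
    by (metis inner_commute vector_eq_rdot)
qed

lemma moreau_envelope_attained:
  fixes f :: "'a::euclidean_space \<Rightarrow> real"
  assumes wc: "weakly_convex \<rho> f" and lam0: "lam > 0" and m: "\<And>y. m \<le> f y"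
  obtains y where "moreau_envelope lam f x = f y + 1 / (2 * lam) * (norm (y - x))\<^sup>2"
    and "\<And>z. moreau_envelope lam f x \<le> f z + 1 / (2 * lam) * (norm (z - x))\<^sup>2"
proof -
  define h where "h z = f z + 1 / (2 * lam) * (norm (z - x))\<^sup>2" for z
  have "continuous_on UNIV (\<lambda>z. f z + \<rho> / 2 * (norm z)\<^sup>2)"
    using wc unfolding weakly_convex_def by (intro convex_on_continuous) auto
  then have "continuous_on UNIV (\<lambda>z. (f z + \<rho> / 2 * (norm z)\<^sup>2) - \<rho> / 2 * (norm z)\<^sup>2)"
    by (rule continuous_on_diff) (intro continuous_intros)
  then have cf: "continuous_on UNIV f" by (simp only: add_diff_cancel)
  define R where "R = sqrt (2 * lam * (f x - m))"
  have "R \<ge> 0" and R2: "R\<^sup>2 = 2 * lam * (f x - m)"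
    using m[of x] lam0 by (simp_all add: R_def)
  have "continuous_on (cball x R) h"
    unfolding h_def by (intro continuous_intros continuous_on_subset[OF cf]) auto
  then obtain y where y: "\<And>z. z \<in> cball x R \<Longrightarrow> h y \<le> h z"
    using continuous_attains_inf[of "cball x R" h] \<open>R \<ge> 0\<close> by fastforce
  have le: "h y \<le> h z" for z
  proof (cases "z \<in> cball x R")
    case False
    then have "R < norm (z - x)" by (simp add: dist_norm norm_minus_commute)
    then have "R\<^sup>2 < (norm (z - x))\<^sup>2" using \<open>R \<ge> 0\<close> by (intro power_strict_mono) auto
    then have "f x - m \<le> 1 / (2 * lam) * (norm (z - x))\<^sup>2"
      using lam0 unfolding R2 by (simp add: field_simps)
    then have "h x \<le> h z" using m[of z] by (simp add: h_def)
    moreover have "h y \<le> h x" using y[of x] \<open>R \<ge> 0\<close> by simp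
    ultimately show ?thesis by simp
  qed (rule y)
  have "moreau_envelope lam f x = h y"
    unfolding moreau_envelope_def h_def[symmetric]
    by (rule cInf_eq_minimum) (use le in auto)
  then show thesis using that[of y] le by (simp add: h_def)
qed

lemma moreau_envelope_differentiable:
  fixes f :: "'a::euclidean_space \<Rightarrow> real"
  assumes wc: "weakly_convex \<rho> f" and rho: "\<rho> \<ge> 0" and lam0: "lam > 0"
    and lr: "\<rho> > 0 \<longrightarrow> lam < 1 / \<rho>" and m: "\<And>y. m \<le> f y"
  shows "GDERIV (moreau_envelope lam f) x :> gradient (moreau_envelope lam f) x"
proof -
  let ?F = "moreau_envelope lam f"
  have lr1: "lam * \<rho> < 1" using rho lr by (cases "\<rho> = 0") (auto simp: field_simps)
  obtain y where y: "?F x = f y + 1 / (2 * lam) * (norm (y - x))\<^sup>2"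
    and ymin: "\<And>z. ?F x \<le> f z + 1 / (2 * lam) * (norm (z - x))\<^sup>2"
    using moreau_envelope_attained[OF wc lam0 m] by blast
  define v where "v = (1 / lam) *\<^sub>R (x - y)"
  have xy: "x = y + lam *\<^sub>R v" using lam0 by (simp add: v_def)
  have sub: "f (y + u) \<ge> f y + v \<bullet> u - \<rho> / 2 * (norm u)\<^sup>2" for u
  proof -
    have ineq: "0 \<le> (f (y + u) - f y) + \<rho> / 2 * (1 - t) * (norm u)\<^sup>2 - v \<bullet> u
                 + t / (2 * lam) * (norm u)\<^sup>2" if t: "0 < t" "t < 1" for t
    proof -
      define A where "A = f (y + t *\<^sub>R u)"
      have e: "(1 - t) *\<^sub>R y + t *\<^sub>R (y + u) = y + t *\<^sub>R u" by (simp add: algebra_simps)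
      have cv: "A + \<rho> / 2 * (norm (y + t *\<^sub>R u))\<^sup>2
          \<le> (1 - t) * (f y + \<rho> / 2 * (norm y)\<^sup>2) + t * (f (y + u) + \<rho> / 2 * (norm (y + u))\<^sup>2)"
        using convex_onD[OF wc[unfolded weakly_convex_def], of t y "y + u"] t
        unfolding e A_def by simp
      have n1: "(norm (y + t *\<^sub>R u))\<^sup>2 = (norm y)\<^sup>2 + 2 * t * (y \<bullet> u) + t\<^sup>2 * (norm u)\<^sup>2"
        unfolding power2_norm_eq_inner
        by (simp add: inner_simps algebra_simps inner_commute power2_eq_square)
      have n2: "(norm (y + u))\<^sup>2 = (norm y)\<^sup>2 + 2 * (y \<bullet> u) + (norm u)\<^sup>2"
        unfolding power2_norm_eq_inner
        by (simp add: inner_simps algebra_simps inner_commute power2_eq_square)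
      have A: "A \<le> f y + t * (f (y + u) - f y) + \<rho> / 2 * (t * (1 - t)) * (norm u)\<^sup>2"
        using cv unfolding n1 n2
        by (simp add: algebra_simps power2_eq_square add_divide_distrib diff_divide_distrib)
      have n3: "(norm (y + t *\<^sub>R u - x))\<^sup>2
          = (norm (y - x))\<^sup>2 - 2 * t * lam * (v \<bullet> u) + t\<^sup>2 * (norm u)\<^sup>2"
        
        unfolding xy power2_norm_eq_inner
        by (simp add: inner_simps algebra_simps inner_commute power2_eq_square)
      have "1 / (2 * lam) * (norm (y + t *\<^sub>R u - x))\<^sup>2
          = 1 / (2 * lam) * (norm (y - x))\<^sup>2 - t * (v \<bullet> u) + t\<^sup>2 / (2 * lam) * (norm u)\<^sup>2"
        unfolding n3 using lam0 by (simp add: add_divide_distrib diff_divide_distrib algebra_simps)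
      then have "f y \<le> A - t * (v \<bullet> u) + t\<^sup>2 / (2 * lam) * (norm u)\<^sup>2"
        using ymin[of "y + t *\<^sub>R u"] unfolding y A_def by linarith
      with A have "0 \<le> t * (f (y + u) - f y) + \<rho> / 2 * (t * (1 - t)) * (norm u)\<^sup>2
          - t * (v \<bullet> u) + t\<^sup>2 / (2 * lam) * (norm u)\<^sup>2" by linarith
      also have "\<dots> = t * ((f (y + u) - f y) + \<rho> / 2 * (1 - t) * (norm u)\<^sup>2 - v \<bullet> u
                 + t / (2 * lam) * (norm u)\<^sup>2)"
        by (simp add: algebra_simps power2_eq_square)
      finally show ?thesis using t by (simp add: zero_le_mult_iff)
    qed
    let ?q = "\<lambda>t. (f (y + u) - f y) + \<rho> / 2 * (1 - t) * (norm u)\<^sup>2 - v \<bullet> u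
                 + t / (2 * lam) * (norm u)\<^sup>2"
    have "((?q) \<longlongrightarrow> ?q 0) (at_right 0)"
      using lam0 by (intro tendsto_intros) auto
    moreover have "\<forall>\<^sub>F t in at_right 0. 0 \<le> ?q t"
      unfolding eventually_at_right_field using ineq by (intro exI[of _ 1]) auto
    ultimately have "0 \<le> ?q 0" by (rule tendsto_lowerbound) simp
    then show ?thesis by simp
  qed
  define C where "C = 1 / (2 * lam) + \<rho> / (2 * (1 - lam * \<rho>))"
  have Cge: "1 / (2 * lam) \<le> C" "\<rho> / (2 * (1 - lam * \<rho>)) \<le> C"
    using lam0 rho lr1 by (simp_all add: C_def)
  have Fx: "?F x = f y + lam / 2 * (norm v)\<^sup>2"
    unfolding y using lam0 by (simp add: xy power_mult_distrib power2_eq_square field_simps)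
  have quad: "\<bar>?F (x + h) - ?F x - h \<bullet> v\<bar> \<le> C * (norm h)\<^sup>2" for h
  proof -
    obtain z where z: "?F (x + h) = f z + 1 / (2 * lam) * (norm (z - (x + h)))\<^sup>2"
      and zmin: "\<And>w. ?F (x + h) \<le> f w + 1 / (2 * lam) * (norm (w - (x + h)))\<^sup>2"
      using moreau_envelope_attained[OF wc lam0 m] by blast
    have n: "1 / (2 * lam) * (norm (y + u - (x + h)))\<^sup>2
        = lam / 2 * (norm v)\<^sup>2 + h \<bullet> v - v \<bullet> u + 1 / (2 * lam) * (norm (u - h))\<^sup>2" for u
    proof -
      have "(norm (y + u - (x + h)))\<^sup>2
          = (norm (u - h))\<^sup>2 - 2 * lam * (v \<bullet> u) + 2 * lam * (h \<bullet> v) + lam\<^sup>2 * (norm v)\<^sup>2"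
        
        unfolding xy power2_norm_eq_inner
        by (simp add: inner_simps algebra_simps inner_commute power2_eq_square)
      then show ?thesis using lam0 by (simp add: field_simps power2_eq_square)
    qed
    have up: "?F (x + h) - ?F x - h \<bullet> v \<le> 1 / (2 * lam) * (norm h)\<^sup>2"
      using zmin[of y] n[of 0] unfolding Fx by simp
    define u where "u = z - y"
    have zu: "z = y + u" by (simp add: u_def)
    have lo: "?F (x + h) - ?F x - h \<bullet> v \<ge> 1 / (2 * lam) * (norm (u - h))\<^sup>2 - \<rho> / 2 * (norm u)\<^sup>2"
      using sub[of u] n[of u] unfolding z Fx zu by simp
    define d where "d = 1 - lam * \<rho>"
    have d: "d > 0" using lr1 by (simp add: d_def)
    have rl: "lam * \<rho> = 1 - d" by (simp add: d_def)
    have "0 \<le> (norm (d *\<^sub>R u - h))\<^sup>2" by simp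
    also have "\<dots> = d * ((norm (u - h))\<^sup>2 - (1 - d) * (norm u)\<^sup>2) + (1 - d) * (norm h)\<^sup>2"
        unfolding power2_norm_eq_inner
        by (simp add: inner_simps algebra_simps inner_commute power2_eq_square)
    finally have "0 \<le> d * ((norm (u - h))\<^sup>2 - lam * \<rho> * (norm u)\<^sup>2) + lam * \<rho> * (norm h)\<^sup>2"
      by (simp add: rl)
    then have "1 / (2 * lam) * (norm (u - h))\<^sup>2 - \<rho> / 2 * (norm u)\<^sup>2
        \<ge> - (\<rho> / (2 * d) * (norm h)\<^sup>2)"
      using lam0 d by (simp add: field_simps)
    with lo have "?F (x + h) - ?F x - h \<bullet> v \<ge> - (\<rho> / (2 * d) * (norm h)\<^sup>2)" by linarith
    moreover have "\<rho> / (2 * d) * (norm h)\<^sup>2 \<le> C * (norm h)\<^sup>2"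
        "1 / (2 * lam) * (norm h)\<^sup>2 \<le> C * (norm h)\<^sup>2"
      using Cge unfolding d_def by (intro mult_right_mono; simp only: zero_le_power2)+
    ultimately show ?thesis using up by linarith
  qed
  have "GDERIV ?F x :> v"
    unfolding gderiv_def has_derivative_at
  proof (intro conjI)
    show "bounded_linear (\<lambda>h. h \<bullet> v)" by (rule bounded_linear_inner_left)
    have lim: "((\<lambda>h::'a. C * norm h) \<longlongrightarrow> 0) (at 0)"
      by (rule tendsto_mult_right_zero[OF tendsto_norm_zero[OF tendsto_ident_at]])
    show "(\<lambda>h. norm (?F (x + h) - ?F x - h \<bullet> v) / norm h) \<midarrow>0\<rightarrow> 0"
    proof (rule tendsto_sandwich[OF _ _ tendsto_const lim])
      show "\<forall>\<^sub>F h in at 0. norm (?F (x + h) - ?F x - h \<bullet> v) / norm h \<le> C * norm h"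
        unfolding eventually_at_filter
        by (rule always_eventually)
           (use quad in \<open>auto simp: divide_le_eq power2_eq_square mult.assoc\<close>)
    qed simp
  qed
  then show ?thesis using gradient_eqI by metis
qed

end

theory Submission
  imports Defs
begin

text \<open>
  Write \<open>v k\<close> for the gradient of the envelope at \<open>x k\<close>. The proximal point \<open>x k - lam v k\<close> is a
  competitor in the envelope at \<open>x (k + 1)\<close>, and combining the subgradient inequality at \<open>x k\<close> with the
  one at the proximal point shows that one step increases the envelope by at most
  \<open>- \<alpha> k (1 - lam \<rho>) |v k|^2 + (\<beta> k)^2 / (2 lam)\<close>. This confines the trajectory to a bounded
  set, on which subgradients are bounded even though \<open>f\<close> need not be globally Lipschitz; hence
  \<open>\<beta> k |v k|^2\<close> is summable. As the gradient of the envelope is Lipschitz, \<open>|v k|\<close> changes by at most a multiple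
  of \<open>\<beta> k\<close> in one step, and since \<open>\<beta>\<close> is not summable this forces \<open>v k\<close> to tend to 0.
\<close>

section \<open>Weak subgradients and weak convexity as inequalities with a quadratic error\<close>

lemma norm_add_scaleR_sq:
  fixes a u :: "'a::real_inner"
  shows "(norm (a + t *\<^sub>R u))\<^sup>2 = (norm a)\<^sup>2 + 2 * t * (a \<bullet> u) + t\<^sup>2 * (norm u)\<^sup>2"
  unfolding power2_norm_eq_inner
  by (simp add: inner_simps algebra_simps inner_commute power2_eq_square)

lemma norm_add_sq:
  fixes a u :: "'a::real_inner"
  shows "(norm (a + u))\<^sup>2 = (norm a)\<^sup>2 + 2 * (a \<bullet> u) + (norm u)\<^sup>2"
  using norm_add_scaleR_sq[of a 1 u] by simp

text \<open>Expanding |x + u|^2 produces exactly the linear term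
  \<open>\<rho> * (x \<bullet> u)\<close> by which the subgradient is shifted, so only the square of
  \<open>u\<close> survives. Later arguments use subgradients in this form.\<close>

lemma weak_subdifferential_iff:
  fixes f :: "'a::real_inner \<Rightarrow> real"
  shows "g \<in> weak_subdifferential \<rho> f x \<longleftrightarrow>
    (\<forall>u. f (x + u) \<ge> f x + g \<bullet> u - \<rho> / 2 * (norm u)\<^sup>2)"
proof -
  have "g \<in> weak_subdifferential \<rho> f x \<longleftrightarrow>
      g + \<rho> *\<^sub>R x \<in> convex_subdifferential (\<lambda>y. f y + \<rho> / 2 * (norm y)\<^sup>2) x"
    unfolding weak_subdifferential_def by (auto intro: image_eqI[where x = "g + \<rho> *\<^sub>R x"])
  also have "\<dots> \<longleftrightarrow> (\<forall>u. f (x + u) + \<rho> / 2 * (norm (x + u))\<^sup>2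
      \<ge> f x + \<rho> / 2 * (norm x)\<^sup>2 + (g + \<rho> *\<^sub>R x) \<bullet> u)"
    unfolding convex_subdifferential_def by (auto dest: spec[of _ "x + _"])
      (metis add_diff_cancel_left' add.commute diff_add_cancel)
  also have "\<dots> \<longleftrightarrow> (\<forall>u. f (x + u) \<ge> f x + g \<bullet> u - \<rho> / 2 * (norm u)\<^sup>2)"
    by (simp add: norm_add_sq inner_simps inner_commute[of x] algebra_simps)
  finally show ?thesis .
qed

lemma weak_subdifferentialD:
  fixes f :: "'a::real_inner \<Rightarrow> real"
  assumes "g \<in> weak_subdifferential \<rho> f x"
  shows "f z \<ge> f x + g \<bullet> (z - x) - \<rho> / 2 * (norm (z - x))\<^sup>2"
  using assms[unfolded weak_subdifferential_iff, rule_format, of "z - x"] by simp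

lemma weakly_convex_continuous:
  fixes f :: "'a::euclidean_space \<Rightarrow> real"
  assumes "weakly_convex \<rho> f"
  shows "continuous_on UNIV f"
proof -
  have "continuous_on UNIV (\<lambda>z. f z + \<rho> / 2 * (norm z)\<^sup>2)"
    using assms unfolding weakly_convex_def by (intro convex_on_continuous) auto
  then have "continuous_on UNIV (\<lambda>z. (f z + \<rho> / 2 * (norm z)\<^sup>2) - \<rho> / 2 * (norm z)\<^sup>2)"
    by (rule continuous_on_diff) (intro continuous_intros)
  then show ?thesis by (simp only: add_diff_cancel)
qed

text \<open>The error term is the identity (1 - t)|y|^2 + t|y + u|^2 - |y + t u|^2 = t(1 -
  t)|u|^2.\<close>

lemma weakly_convex_segment:
  fixes f :: "'a::real_inner \<Rightarrow> real"
  assumes "weakly_convex \<rho> f" and "0 \<le> t" "t \<le> 1"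
  shows "f (y + t *\<^sub>R u) \<le> (1 - t) * f y + t * f (y + u) + \<rho> / 2 * (t * (1 - t)) * (norm u)\<^sup>2"
proof -
  have "(1 - t) *\<^sub>R y + t *\<^sub>R (y + u) = y + t *\<^sub>R u" by (simp add: algebra_simps)
  then have "f (y + t *\<^sub>R u) + \<rho> / 2 * (norm (y + t *\<^sub>R u))\<^sup>2
      \<le> (1 - t) * (f y + \<rho> / 2 * (norm y)\<^sup>2) + t * (f (y + u) + \<rho> / 2 * (norm (y + u))\<^sup>2)"
    using convex_onD[OF assms(1)[unfolded weakly_convex_def], of t y "y + u"] assms(2,3) by simp
  then show ?thesis
    unfolding norm_add_scaleR_sq norm_add_sq
    by (simp add: algebra_simps power2_eq_square add_divide_distrib diff_divide_distrib)
qed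

section \<open>Proximal points and the gradient of the Moreau envelope\<close>

lemma proximal_point_subgradient:
  fixes f :: "'a::real_inner \<Rightarrow> real"
  assumes wc: "weakly_convex \<rho> f" and lam: "lam > 0"
    and min: "\<And>z. f y + 1 / (2 * lam) * (norm (y - x))\<^sup>2 \<le> f z + 1 / (2 * lam) * (norm (z - x))\<^sup>2"
  shows "(1 / lam) *\<^sub>R (x - y) \<in> weak_subdifferential \<rho> f y"
  unfolding weak_subdifferential_iff
proof
  fix u
  define v where "v = (1 / lam) *\<^sub>R (x - y)"
  \<comment> \<open>First-order optimality: comparing \<open>y\<close> with
    \<open>y + t *\<^sub>R u\<close> and dividing by \<open>t\<close> gives
    \<open>0 \<le> ?q t\<close>. The subgradient inequality is the limit as \<open>t\<close>
    decreases to 0.\<close>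
  let ?q = "\<lambda>t. f (y + u) - f y - v \<bullet> u + \<rho> / 2 * (1 - t) * (norm u)\<^sup>2
    + t / (2 * lam) * (norm u)\<^sup>2"
  have q: "0 \<le> ?q t" if t: "0 < t" "t < 1" for t
  proof -
    have yx: "y - x = - (lam *\<^sub>R v)" using lam by (simp add: v_def)
    have "(norm (y + t *\<^sub>R u - x))\<^sup>2 = (norm (y - x))\<^sup>2 + 2 * t * ((y - x) \<bullet> u) + t\<^sup>2 * (norm u)\<^sup>2"
      using norm_add_scaleR_sq[of "y - x" t u] by (simp add: algebra_simps)
    then have "1 / (2 * lam) * (norm (y + t *\<^sub>R u - x))\<^sup>2
        = 1 / (2 * lam) * (norm (y - x))\<^sup>2 - t * (v \<bullet> u) + t\<^sup>2 / (2 * lam) * (norm u)\<^sup>2"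
      unfolding yx using lam by (simp add: field_simps)
    then have "f y \<le> f (y + t *\<^sub>R u) - t * (v \<bullet> u) + t\<^sup>2 / (2 * lam) * (norm u)\<^sup>2"
      using min[of "y + t *\<^sub>R u"] by linarith
    moreover have "f (y + t *\<^sub>R u)
        \<le> (1 - t) * f y + t * f (y + u) + \<rho> / 2 * (t * (1 - t)) * (norm u)\<^sup>2"
      using weakly_convex_segment[OF wc] t by simp
    ultimately have "0 \<le> t * ?q t"
      by (simp add: algebra_simps power2_eq_square)
    then show ?thesis using t by (simp add: zero_le_mult_iff)
  qed
  have "(?q \<longlongrightarrow> ?q 0) (at_right 0)"
    using lam by (intro tendsto_intros) auto
  moreover have "\<forall>\<^sub>F t in at_right 0. 0 \<le> ?q t"
    unfolding eventually_at_right_field using q by (intro exI[of _ 1]) auto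
  ultimately have "0 \<le> ?q 0" by (rule tendsto_lowerbound) simp
  then show "f y + ((1 / lam) *\<^sub>R (x - y)) \<bullet> u - \<rho> / 2 * (norm u)\<^sup>2 \<le> f (y + u)"
    by (simp add: v_def)
qed

text \<open>The proximal point is recovered from the gradient as
  \<open>x - lam *\<^sub>R gradient F x\<close>. Phrasing both facts through the gradient avoids
  choosing a minimizer later.\<close>

lemma moreau_envelope_gradient:
  fixes f :: "'a::euclidean_space \<Rightarrow> real"
  assumes wc: "weakly_convex \<rho> f" and rho: "\<rho> \<ge> 0" and lam: "lam > 0"
    and lr: "\<rho> > 0 \<longrightarrow> lam < 1 / \<rho>" and m: "\<And>y. m \<le> f y"
  defines "F \<equiv> moreau_envelope lam f"
  shows "F x = f (x - lam *\<^sub>R gradient F x) + lam / 2 * (norm (gradient F x))\<^sup>2"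
    and "gradient F x \<in> weak_subdifferential \<rho> f (x - lam *\<^sub>R gradient F x)"
proof -
  obtain p where p: "F x = f p + 1 / (2 * lam) * (norm (p - x))\<^sup>2"
    and pmin: "\<And>z. F x \<le> f z + 1 / (2 * lam) * (norm (z - x))\<^sup>2"
    unfolding F_def using moreau_envelope_attained[OF wc lam m] by blast
  define v where "v = (1 / lam) *\<^sub>R (x - p)"
  have pv: "p = x - lam *\<^sub>R v" using lam by (simp add: v_def)
  have le: "F z \<le> f p + 1 / (2 * lam) * (norm (p - z))\<^sup>2" for z
    unfolding F_def using moreau_envelope_attained[OF wc lam m, of z] by metis
  have dF: "(F has_derivative (\<lambda>h. h \<bullet> gradient F x)) (at x)"
    using moreau_envelope_differentiable[OF wc rho lam lr m, of x] by (simp add: F_def gderiv_def)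
  \<comment> \<open>As \<open>p\<close> competes in the envelope at every \<open>z\<close>,
    \<open>?q\<close> is nonnegative; it vanishes at \<open>x\<close>. Hence its derivative there is
    0, which identifies the gradient with \<open>v\<close>.\<close>
  let ?q = "\<lambda>z. f p + 1 / (2 * lam) * ((z - p) \<bullet> (z - p)) - F z"
  have "(?q has_derivative (\<lambda>h. h \<bullet> (v - gradient F x))) (at x)"
    by (rule derivative_eq_intros dF | rule refl)+
      (use lam in \<open>auto simp: fun_eq_iff v_def inner_simps inner_commute field_simps\<close>)
  moreover have "\<forall>z\<in>ball x 1. ?q x \<le> ?q z"
    using le p by (simp add: power2_norm_eq_inner[symmetric] norm_minus_commute)
  ultimately have "(\<lambda>h. h \<bullet> (v - gradient F x)) = (\<lambda>h. 0)"
    by (intro has_derivative_local_min[of ?q _ x]) (auto simp: eventually_at dist_commute intro!: exI[of _ 1])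
  then have v: "gradient F x = v"
    by (metis inner_eq_zero_iff right_minus_eq)
  have "(norm (p - x))\<^sup>2 = lam\<^sup>2 * (norm v)\<^sup>2"
    unfolding pv by (simp add: power_mult_distrib)
  then show "F x = f (x - lam *\<^sub>R gradient F x) + lam / 2 * (norm (gradient F x))\<^sup>2"
    using p lam unfolding v pv[symmetric] by (simp add: power2_eq_square)
  show "gradient F x \<in> weak_subdifferential \<rho> f (x - lam *\<^sub>R gradient F x)"
    unfolding v pv[symmetric] unfolding v_def
    by (rule proximal_point_subgradient[OF wc lam]) (use pmin p in simp)
qed

lemma moreau_envelope_le:
  fixes f :: "'a::real_normed_vector \<Rightarrow> real"
  assumes "lam > 0" and "\<And>y. m \<le> f y"
  shows "moreau_envelope lam f x \<le> f z + 1 / (2 * lam) * (norm (z - x))\<^sup>2"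
  unfolding moreau_envelope_def
  by (rule cINF_lower) (use assms in \<open>auto intro!: bdd_belowI[of _ m] simp: add_increasing2\<close>)

text \<open>
  The proximal map is Lipschitz with constant \<open>1 / (1 - lam \<rho>)\<close>, by adding the subgradient
  inequalities between two proximal points.
\<close>

lemma moreau_envelope_gradient_lipschitz:
  fixes f :: "'a::euclidean_space \<Rightarrow> real"
  assumes wc: "weakly_convex \<rho> f" and rho: "\<rho> \<ge> 0" and lam: "lam > 0"
    and lr: "\<rho> > 0 \<longrightarrow> lam < 1 / \<rho>" and m: "\<And>y. m \<le> f y"
  defines "F \<equiv> moreau_envelope lam f"
  shows "norm (gradient F x - gradient F y) \<le> (1 + 1 / (1 - lam * \<rho>)) / lam * norm (x - y)"
proof -
  define d where "d = 1 - lam * \<rho>"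
  have d: "d > 0" unfolding d_def using rho lr by (cases "\<rho> = 0") (auto simp: field_simps)
  note gr = moreau_envelope_gradient(2)[OF wc rho lam lr m, folded F_def]
  define p q where "p = x - lam *\<^sub>R gradient F x" and "q = y - lam *\<^sub>R gradient F y"
  have gx: "lam *\<^sub>R gradient F x = x - p" and gy: "lam *\<^sub>R gradient F y = y - q"
    by (simp_all add: p_def q_def)
  have "f q \<ge> f p + gradient F x \<bullet> (q - p) - \<rho> / 2 * (norm (q - p))\<^sup>2"
    and "f p \<ge> f q + gradient F y \<bullet> (p - q) - \<rho> / 2 * (norm (q - p))\<^sup>2"
    using weak_subdifferentialD[OF gr[of x], of q] weak_subdifferentialD[OF gr[of y], of p]
    by (simp_all add: p_def q_def norm_minus_commute)
  then have "gradient F x \<bullet> (q - p) + gradient F y \<bullet> (p - q) \<le> \<rho> * (norm (p - q))\<^sup>2"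
    by (simp add: norm_minus_commute)
  then have "lam * (gradient F x \<bullet> (q - p) + gradient F y \<bullet> (p - q)) \<le> lam * (\<rho> * (norm (p - q))\<^sup>2)"
    using lam by (intro mult_left_mono) auto
  then have "(x - p) \<bullet> (q - p) + (y - q) \<bullet> (p - q) \<le> lam * \<rho> * (norm (p - q))\<^sup>2"
    unfolding gx[symmetric] gy[symmetric] by (simp add: algebra_simps)
  moreover have "(x - p) \<bullet> (q - p) + (y - q) \<bullet> (p - q) = (norm (p - q))\<^sup>2 - (x - y) \<bullet> (p - q)"
    unfolding power2_norm_eq_inner by (simp add: inner_simps algebra_simps inner_commute)
  \<comment> \<open>Subgradients are monotone up to \<open>\<rho>\<close>, and
    \<open>lam * \<rho> < 1\<close> leaves the positive factor \<open>d\<close>.\<close>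
  ultimately have "d * (norm (p - q))\<^sup>2 \<le> (x - y) \<bullet> (p - q)"
    by (simp add: d_def algebra_simps)
  also have "\<dots> \<le> norm (x - y) * norm (p - q)" by (rule norm_cauchy_schwarz)
  finally have "norm (p - q) * (d * norm (p - q)) \<le> norm (p - q) * norm (x - y)"
    by (simp add: power2_eq_square ac_simps)
  then have pq: "norm (p - q) \<le> norm (x - y) / d"
    using d by (cases "norm (p - q) = 0") (auto simp: field_simps)
  \<comment> \<open>Up to the factor \<open>lam\<close>, the gradient is the identity minus the
    proximal map, so the two Lipschitz constants add.\<close>
  have "lam * norm (gradient F x - gradient F y) = norm (lam *\<^sub>R (gradient F x - gradient F y))"
    using lam by simp
  also have "\<dots> = norm ((x - y) - (p - q))"
    by (simp add: gx gy scaleR_diff_right algebra_simps)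
  also have "\<dots> \<le> norm (x - y) + norm (x - y) / d"
    using norm_triangle_ineq4[of "x - y" "p - q"] pq by linarith
  finally show ?thesis using lam d unfolding d_def[symmetric] by (simp add: field_simps)
qed

section \<open>Boundedness, limits of subgradients and a criterion for null sequences\<close>

lemma moreau_envelope_bounded_sublevel:
  fixes f :: "'a::euclidean_space \<Rightarrow> real"
  assumes wc: "weakly_convex \<rho> f" and lam: "lam > 0" and m: "\<And>y. m \<le> f y"
    and bs: "bounded_sublevel_sets f"
  shows "bounded {y. moreau_envelope lam f y \<le> s}"
proof -
  obtain B where B: "\<And>p. f p \<le> s \<Longrightarrow> norm p \<le> B"
    using bs unfolding bounded_sublevel_sets_def bounded_iff by blast
  have "norm y \<le> B + sqrt (2 * lam * (s - m))" if y: "moreau_envelope lam f y \<le> s" for y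
  proof -
    obtain p where p: "moreau_envelope lam f y = f p + 1 / (2 * lam) * (norm (p - y))\<^sup>2"
      using moreau_envelope_attained[OF wc lam m] by metis
    \<comment> \<open>The envelope value bounds \<open>f p\<close>, and it bounds the proximal term
      by \<open>s - m\<close>: \<open>p\<close> lies in a sublevel set of \<open>f\<close>, and
      \<open>y\<close> lies near \<open>p\<close>.\<close>
    have "0 \<le> 1 / (2 * lam) * (norm (p - y))\<^sup>2" using lam by simp
    then have 1: "norm p \<le> B" using B y p by simp
    have "1 / (2 * lam) * (norm (p - y))\<^sup>2 \<le> s - m" using p y m[of p] by linarith
    then have "(norm (p - y))\<^sup>2 \<le> 2 * lam * (s - m)" using lam by (simp add: field_simps)
    then have "norm (p - y) \<le> sqrt (2 * lam * (s - m))" by (rule real_le_rsqrt)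
    with 1 show ?thesis using norm_triangle_sub[of y p] by (simp add: norm_minus_commute)
  qed
  then show ?thesis unfolding bounded_iff by blast
qed

text \<open>A unit step along the subgradient raises \<open>f\<close> by at least
  \<open>norm g - \<rho> / 2\<close>, while \<open>f\<close> is bounded on a ball of radius larger
  by 1. The maximum with 1 makes \<open>G\<close> positive.\<close>

lemma weak_subdifferential_bounded:
  fixes f :: "'a::euclidean_space \<Rightarrow> real"
  assumes wc: "weakly_convex \<rho> f" and m: "\<And>y. m \<le> f y" and S: "bounded S"
  obtains G where "G > 0" and "\<And>x g. x \<in> S \<Longrightarrow> g \<in> weak_subdifferential \<rho> f x \<Longrightarrow> norm g \<le> G"
proof -
  obtain B where B: "\<And>x. x \<in> S \<Longrightarrow> norm x \<le> B" using S unfolding bounded_iff by blast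
  have "bounded (f ` cball 0 (B + 1))"
    by (intro compact_imp_bounded compact_continuous_image
        continuous_on_subset[OF weakly_convex_continuous[OF wc]]) auto
  then obtain M where M: "\<And>x. norm x \<le> B + 1 \<Longrightarrow> \<bar>f x\<bar> \<le> M"
    unfolding bounded_iff by (metis image_eqI mem_cball_0 real_norm_def)
  have "norm g \<le> max 1 (M - m + \<rho> / 2)"
    if x: "x \<in> S" and g: "g \<in> weak_subdifferential \<rho> f x" for x g
  proof (cases "g = 0")
    case False
    have n: "norm (sgn g) = 1" using False by (simp add: norm_sgn)
    have "g \<bullet> sgn g = norm g"
      using False by (simp add: sgn_div_norm power2_norm_eq_inner[symmetric] power2_eq_square)
    then have "f (x + sgn g) \<ge> f x + norm g - \<rho> / 2"
      using g[unfolded weak_subdifferential_iff, rule_format, of "sgn g"] n by simp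
    moreover have "f (x + sgn g) \<le> M"
      using M[of "x + sgn g"] norm_triangle_ineq[of x "sgn g"] B[OF x] n by simp
    ultimately show ?thesis using m[of x] by simp
  qed simp
  then show thesis using that[of "max 1 (M - m + \<rho> / 2)"] by force
qed

text \<open>Used to pass from proximal points to accumulation points: every term of the subgradient
  inequality is continuous in the moving data.\<close>

lemma weak_subdifferential_closed_graph:
  fixes f :: "'a::real_inner \<Rightarrow> real"
  assumes "continuous_on UNIV f" and "\<And>n. v n \<in> weak_subdifferential \<rho> f (p n)"
    and p: "p \<longlonglongrightarrow> y" and v: "v \<longlonglongrightarrow> w"
  shows "w \<in> weak_subdifferential \<rho> f y"
  unfolding weak_subdifferential_iff
proof
  fix u
  have c: "(\<lambda>n. f (q n)) \<longlonglongrightarrow> f z" if "q \<longlonglongrightarrow> z" for q z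
    using continuous_on_tendsto_compose[OF assms(1) that] by simp
  have "(\<lambda>n. f (p n + u)) \<longlonglongrightarrow> f (y + u)"
    by (intro c tendsto_intros p)
  moreover have "(\<lambda>n. f (p n) + v n \<bullet> u - \<rho> / 2 * (norm u)\<^sup>2) \<longlonglongrightarrow> f y + w \<bullet> u - \<rho> / 2 * (norm u)\<^sup>2"
    by (intro tendsto_intros c p v)
  ultimately show "f y + w \<bullet> u - \<rho> / 2 * (norm u)\<^sup>2 \<le> f (y + u)"
    by (rule tendsto_le[OF sequentially_bot])
      (use assms(2) in \<open>auto simp: weak_subdifferential_iff\<close>)
qed

text \<open>Summability against a divergent weight only gives arbitrarily late small terms. The
  one-sided increment bound rules out later excursions: a climb takes place at levels where the
  weighted squares are large.\<close>

lemma tendsto_zero_of_weighted_square_summable: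
  fixes a \<beta> :: "nat \<Rightarrow> real"
  assumes a: "\<And>k. a k \<ge> 0" and b: "\<And>k. \<beta> k > 0"
    and div: "filterlim (\<lambda>n. \<Sum>k<n. \<beta> k) at_top sequentially"
    and b0: "\<beta> \<longlonglongrightarrow> 0" and sm: "summable (\<lambda>k. \<beta> k * (a k)\<^sup>2)"
    and L: "L \<ge> 0" and inc: "\<And>k. a (Suc k) \<le> a k + L * \<beta> k"
  shows "a \<longlonglongrightarrow> 0"
proof (rule LIMSEQ_I)
  fix r :: real assume "r > 0"
  \<comment> \<open>The final estimate is \<open>2 * e\<close> from the induction plus
    \<open>e\<close> from the tail, which is below \<open>4 * e\<close>.\<close>
  define e where "e = r / 4"
  then have r: "r = 4 * e" by simp
  have e: "e > 0" using \<open>r > 0\<close> by (simp add: e_def)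
  define S where "S n = (\<Sum>k<n. \<beta> k * (a k)\<^sup>2)" for n
  have S: "S \<longlonglongrightarrow> (\<Sum>k. \<beta> k * (a k)\<^sup>2)" unfolding S_def by (rule summable_LIMSEQ[OF sm])
  have "(\<lambda>n. L * \<beta> n) \<longlonglongrightarrow> L * 0" by (intro tendsto_intros b0)
  then have "\<forall>\<^sub>F n in sequentially. L * \<beta> n < e" by (rule order_tendstoD) (use e in simp)
  moreover have "(\<lambda>n. L / e\<^sup>2 * ((\<Sum>k. \<beta> k * (a k)\<^sup>2) - S n)) \<longlonglongrightarrow> L / e\<^sup>2 * 0"
    using tendsto_diff[OF tendsto_const S, of "\<Sum>k. \<beta> k * (a k)\<^sup>2"]
    by (intro tendsto_mult_left) simp
  then have "\<forall>\<^sub>F n in sequentially. L / e\<^sup>2 * ((\<Sum>k. \<beta> k * (a k)\<^sup>2) - S n) < e"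
    by (rule order_tendstoD) (use e in simp)
  ultimately have "\<forall>\<^sub>F n in sequentially. L * \<beta> n < e \<and> L / e\<^sup>2 * ((\<Sum>k. \<beta> k * (a k)\<^sup>2) - S n) < e"
    by (rule eventually_conj)
  \<comment> \<open>From \<open>N\<close> on, a single increment is below \<open>e\<close>, and so
    is the total increment that the remaining weighted squares can pay for.\<close>
  then obtain N where N: "\<And>n. n \<ge> N \<Longrightarrow> L * \<beta> n < e"
      "\<And>n. n \<ge> N \<Longrightarrow> L / e\<^sup>2 * ((\<Sum>k. \<beta> k * (a k)\<^sup>2) - S n) < e"
    unfolding eventually_sequentially by blast
  \<comment> \<open>Otherwise \<open>\<beta> n * e\<^sup>2\<close> would be dominated by a summable
    series, against the divergence of the sum of \<open>\<beta>\<close>.\<close>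
  have "\<exists>M\<ge>N. a M < e"
  proof (rule ccontr)
    assume "\<not> (\<exists>M\<ge>N. a M < e)"
    then have "\<And>n. n \<ge> N \<Longrightarrow> norm (\<beta> n * e\<^sup>2) \<le> \<beta> n * (a n)\<^sup>2"
      using e b by (auto simp: not_less abs_mult less_imp_le intro!: mult_left_mono power_mono)
    then have "summable (\<lambda>n. \<beta> n * e\<^sup>2)" by (rule summable_comparison_test'[OF sm])
    then have "summable \<beta>" using summable_mult2[of "\<lambda>n. \<beta> n * e\<^sup>2" "inverse (e\<^sup>2)"] e
      by (simp add: field_simps)
    then have "(\<lambda>n. \<Sum>k<n. \<beta> k) \<longlonglongrightarrow> suminf \<beta>" by (rule summable_LIMSEQ)
    then show False using div not_tendsto_and_filterlim_at_infinity[OF sequentially_bot]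
      filterlim_at_top_imp_at_infinity by blast
  qed
  then obtain M where M: "M \<ge> N" "a M < e" by blast
  \<comment> \<open>Above the level \<open>e\<close>, the increment \<open>L * \<beta> n\<close> is paid for by the summable weighted squares.\<close>
  have bound: "a n \<le> 2 * e + L / e\<^sup>2 * (S n - S M)" if "n \<ge> M" for n
    using that
  proof (induction n rule: dec_induct)
    case base then show ?case using M e by simp
  next
    case (step n)
    have Sn: "S (Suc n) = S n + \<beta> n * (a n)\<^sup>2" by (simp add: S_def)
    show ?case
    proof (cases "a n \<ge> e")
      case True
      then have "e\<^sup>2 \<le> (a n)\<^sup>2" using e by (intro power_mono) auto
      then have "L * \<beta> n * e\<^sup>2 \<le> L * \<beta> n * (a n)\<^sup>2"
        using L b[of n] by (intro mult_left_mono) auto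
      then have "L * \<beta> n \<le> L / e\<^sup>2 * (\<beta> n * (a n)\<^sup>2)" using e by (simp add: field_simps)
      then show ?thesis using step.IH inc[of n] unfolding Sn by (simp add: algebra_simps diff_divide_distrib)
    next
      case False
      \<comment> \<open>One step from below \<open>e\<close> ends below \<open>2 * e\<close>, so the
        accumulated term only has to be nonnegative.\<close>
      have "S M \<le> S (Suc n)" unfolding S_def
        using step.hyps b by (intro sum_mono2) (auto simp: less_imp_le)
      then have "0 \<le> L / e\<^sup>2 * (S (Suc n) - S M)" using L by simp
      then show ?thesis using False inc[of n] N(1)[of n] M(1) step.hyps by simp
    qed
  qed
  have "norm (a n - 0) < r" if n: "n \<ge> M" for n
  proof -
    have "S n \<le> (\<Sum>k. \<beta> k * (a k)\<^sup>2)"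
      unfolding S_def by (intro sum_le_suminf sm) (use b in \<open>auto simp: less_imp_le\<close>)
    then have "L / e\<^sup>2 * (S n - S M) \<le> L / e\<^sup>2 * ((\<Sum>k. \<beta> k * (a k)\<^sup>2) - S M)"
      using L by (intro mult_left_mono) auto
    then show ?thesis using bound[OF n] N(2)[OF M(1)] a[of n] e r by simp
  qed
  then show "\<exists>no. \<forall>n\<ge>no. norm (a n - 0) < r" by blast
qed

section \<open>Descent of the envelope along the subgradient method\<close>

lemma subgradient_inner_gradient:
  fixes f :: "'a::euclidean_space \<Rightarrow> real"
  assumes wc: "weakly_convex \<rho> f" and rho: "\<rho> \<ge> 0" and lam: "lam > 0"
    and lr: "\<rho> > 0 \<longrightarrow> lam < 1 / \<rho>" and m: "\<And>y. m \<le> f y"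
    and g: "g \<in> weak_subdifferential \<rho> f x"
  defines "F \<equiv> moreau_envelope lam f"
  shows "g \<bullet> gradient F x \<ge> (1 - lam * \<rho>) * (norm (gradient F x))\<^sup>2"
proof -
  define v where "v = gradient F x"
  have "v \<in> weak_subdifferential \<rho> f (x - lam *\<^sub>R v)"
    unfolding v_def F_def by (rule moreau_envelope_gradient(2)[OF wc rho lam lr m])
  from weak_subdifferentialD[OF this, of x]
  have "f x \<ge> f (x - lam *\<^sub>R v) + lam * (norm v)\<^sup>2 - \<rho> / 2 * (lam\<^sup>2 * (norm v)\<^sup>2)"
    by (simp add: power2_norm_eq_inner power_mult_distrib)
  moreover have "f (x - lam *\<^sub>R v) \<ge> f x - lam * (g \<bullet> v) - \<rho> / 2 * (lam\<^sup>2 * (norm v)\<^sup>2)"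
    using weak_subdifferentialD[OF g, of "x - lam *\<^sub>R v"] by (simp add: power_mult_distrib)
  \<comment> \<open>Adding the two inequalities cancels the values of \<open>f\<close>; their two
    quadratic errors together account for the loss \<open>lam * \<rho>\<close> in the
    factor.\<close>
  ultimately have "lam * ((1 - lam * \<rho>) * (norm v)\<^sup>2) \<le> lam * (g \<bullet> v)"
    by (simp add: algebra_simps power2_eq_square)
  then show ?thesis using lam by (simp add: v_def)
qed

text \<open>Expanding the square around the old proximal point leaves a quadratic upper model of
  \<open>F\<close> with curvature \<open>1 / lam\<close>, valid for any vector
  \<open>g\<close>.\<close>

lemma moreau_envelope_step:
  fixes f :: "'a::euclidean_space \<Rightarrow> real"
  assumes wc: "weakly_convex \<rho> f" and rho: "\<rho> \<ge> 0" and lam: "lam > 0"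
    and lr: "\<rho> > 0 \<longrightarrow> lam < 1 / \<rho>" and m: "\<And>y. m \<le> f y"
  defines "F \<equiv> moreau_envelope lam f"
  shows "F (x - t *\<^sub>R g) \<le> F x - t * (g \<bullet> gradient F x) + (norm (t *\<^sub>R g))\<^sup>2 / (2 * lam)"
proof -
  define v where "v = gradient F x"
  have Fx: "F x = f (x - lam *\<^sub>R v) + lam / 2 * (norm v)\<^sup>2"
    unfolding v_def F_def by (rule moreau_envelope_gradient(1)[OF wc rho lam lr m])
  have "F (x - t *\<^sub>R g) \<le> f (x - lam *\<^sub>R v) + 1 / (2 * lam) * (norm (t *\<^sub>R g + (- lam) *\<^sub>R v))\<^sup>2"
    using moreau_envelope_le[OF lam m, where x = "x - t *\<^sub>R g" and z = "x - lam *\<^sub>R v"]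
    by (simp add: F_def algebra_simps)
  also have "\<dots> = F x - t * (g \<bullet> v) + (norm (t *\<^sub>R g))\<^sup>2 / (2 * lam)"
    unfolding Fx norm_add_scaleR_sq using lam by (simp add: field_simps power2_eq_square)
  finally show ?thesis by (simp add: v_def)
qed

theorem theorem3:
  fixes f :: "'a::euclidean_space \<Rightarrow> real"
    and \<rho> lam b :: real
    and x g :: "nat \<Rightarrow> 'a"
    and \<alpha> \<beta> :: "nat \<Rightarrow> real"
  assumes "\<rho> \<ge> 0" and "weakly_convex \<rho> f"
    and "bounded_sublevel_sets f"
    and "{y. \<forall>z. f y \<le> f z} \<noteq> {}"
    and "0 < lam" and "\<rho> > 0 \<longrightarrow> lam < 1 / \<rho>"
    and "\<And>k. g k \<in> weak_subdifferential \<rho> f (x k)"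
    and "\<And>k. x (Suc k) = x k - \<alpha> k *\<^sub>R g k"
    and "\<And>k. g k \<noteq> 0 \<Longrightarrow> \<alpha> k = \<beta> k / norm (g k)"
    and "\<And>k. \<beta> k > 0"
    and "filterlim (\<lambda>n. \<Sum>k<n. \<beta> k) at_top sequentially"
    and "summable (\<lambda>k. (\<beta> k)\<^sup>2)" and "(\<Sum>k. (\<beta> k)\<^sup>2) \<le> b"
  shows "let D = {y. moreau_envelope lam f y \<le> moreau_envelope lam f (x 0) + b / (2 * lam)} in
      bounded D \<and> (\<forall>k. x k \<in> D)
    \<and> (\<lambda>k. norm (gradient (moreau_envelope lam f) (x k))) \<longlonglongrightarrow> 0
    \<and> (\<forall>y. (\<exists>r. strict_mono r \<and> (x \<circ> r) \<longlonglongrightarrow> y) \<longrightarrow> stationary_point \<rho> f y)"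
proof -
  obtain z0 where m: "\<And>z. f z0 \<le> f z" using assms(4) by blast
  note H = assms(2,1,5,6) m
  define F where "F = moreau_envelope lam f"
  define v where "v k = gradient F (x k)" for k
  define d where "d = 1 - lam * \<rho>"
  have d: "d > 0" unfolding d_def using assms(1,6) by (cases "\<rho> = 0") (auto simp: field_simps)
  have inner: "d * (norm (v k))\<^sup>2 \<le> g k \<bullet> v k" for k
    using subgradient_inner_gradient[OF H assms(7)[of k]] by (simp add: d_def v_def F_def)
  \<comment> \<open>Only an inequality: when \<open>g k = 0\<close> the iterate does not move and
    \<open>\<alpha> k\<close> is arbitrary.\<close>
  have len: "norm (\<alpha> k *\<^sub>R g k) \<le> \<beta> k" for k
    using assms(9)[of k] less_imp_le[OF assms(10)[of k]] by (cases "g k = 0") auto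
  have step: "F (x (Suc k)) \<le> F (x k) - \<alpha> k * (g k \<bullet> v k) + (\<beta> k)\<^sup>2 / (2 * lam)" for k
  proof -
    have "(norm (\<alpha> k *\<^sub>R g k))\<^sup>2 \<le> (\<beta> k)\<^sup>2" using len by (intro power_mono) auto
    then have "(norm (\<alpha> k *\<^sub>R g k))\<^sup>2 / (2 * lam) \<le> (\<beta> k)\<^sup>2 / (2 * lam)"
      using assms(5) by (intro divide_right_mono) auto
    then show ?thesis
      using moreau_envelope_step[OF H, of "x k" "\<alpha> k" "g k"] unfolding assms(8) F_def v_def by linarith
  qed
  have bsum: "(\<Sum>k<n. (\<beta> k)\<^sup>2) \<le> b" for n
    using sum_le_suminf[OF assms(12), of "{..<n}"] assms(13) by simp
  \<comment> \<open>The sign of \<open>\<alpha> k\<close> is unknown when \<open>g k = 0\<close>,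
    but the product is then 0.\<close>
  have "0 \<le> \<alpha> k * (g k \<bullet> v k)" for k
  proof (cases "g k = 0")
    case False
    have "0 \<le> d * (norm (v k))\<^sup>2" using d by simp
    then have "0 \<le> g k \<bullet> v k" using inner[of k] by linarith
    then show ?thesis using assms(9)[OF False] assms(10)[of k] by simp
  qed simp
  then have inc: "F (x (Suc k)) \<le> F (x k) + (\<beta> k)\<^sup>2 / (2 * lam)" for k
    using step[of k] by (smt (verit))
  have "F (x n) \<le> F (x 0) + (\<Sum>k<n. (\<beta> k)\<^sup>2) / (2 * lam)" for n
  proof (induction n)
    case (Suc n)
    then show ?case using inc[of n] by (simp add: add_divide_distrib)
  qed simp
  moreover have "(\<Sum>k<n. (\<beta> k)\<^sup>2) / (2 * lam) \<le> b / (2 * lam)" for n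
    using bsum assms(5) by (intro divide_right_mono) auto
  ultimately have inD: "F (x n) \<le> F (x 0) + b / (2 * lam)" for n
    by (meson add_left_mono order_trans)
  have bd: "bounded {y. F y \<le> F (x 0) + b / (2 * lam)}"
    unfolding F_def by (rule moreau_envelope_bounded_sublevel[OF assms(2,5) m assms(3)])
  obtain G where G: "G > 0" "\<And>k. norm (g k) \<le> G"
    using weak_subdifferential_bounded[OF assms(2) m bd] inD assms(7) by (metis mem_Collect_eq)
  define c where "c = d / G"
  have c: "c > 0" using d G by (simp add: c_def)
  \<comment> \<open>The decrease is rewritten with weight \<open>\<beta> k\<close>. If
    \<open>g k = 0\<close>, then \<open>inner\<close> forces \<open>v k = 0\<close>; otherwise
    \<open>\<alpha> k\<close> is at least \<open>\<beta> k / G\<close>.\<close>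
  have drop: "c * (\<beta> k * (norm (v k))\<^sup>2) \<le> \<alpha> k * (g k \<bullet> v k)" for k
  proof (cases "g k = 0")
    case True
    then have "(norm (v k))\<^sup>2 \<le> 0" using inner[of k] d by (simp add: mult_le_0_iff)
    then show ?thesis using True by simp
  next
    case False
    have "\<beta> k / G \<le> \<alpha> k"
      unfolding assms(9)[OF False] using G False assms(10)[of k] by (intro divide_left_mono) auto
    then have "\<beta> k / G * (d * (norm (v k))\<^sup>2) \<le> \<alpha> k * (g k \<bullet> v k)"
      using inner[of k] d G assms(10)[of k]
      by (intro mult_mono) (auto simp: assms(9)[OF False] less_imp_le)
    then show ?thesis by (simp add: c_def field_simps)
  qed
  have Fm: "f z0 \<le> F y" for y
    unfolding F_def moreau_envelope_def
    by (rule cINF_greatest) (use m assms(5) in \<open>auto intro: add_increasing2\<close>)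
  \<comment> \<open>Summing the one-step estimates telescopes \<open>F\<close>; the lower bound
    \<open>Fm\<close> then bounds the partial sums uniformly in \<open>n\<close>.\<close>
  have tel: "c * (\<Sum>k<n. \<beta> k * (norm (v k))\<^sup>2) \<le> F (x 0) - F (x n) + (\<Sum>k<n. (\<beta> k)\<^sup>2) / (2 * lam)" for n
  proof (induction n)
    case (Suc n)
    then show ?case using step[of n] drop[of n] by (simp add: algebra_simps add_divide_distrib)
  qed simp
  have "(\<Sum>k<n. \<beta> k * (norm (v k))\<^sup>2) \<le> (F (x 0) - f z0 + b / (2 * lam)) / c" for n
  proof -
    have "c * (\<Sum>k<n. \<beta> k * (norm (v k))\<^sup>2) \<le> F (x 0) - f z0 + b / (2 * lam)"
      using tel[of n] Fm[of "x n"] \<open>(\<Sum>k<n. (\<beta> k)\<^sup>2) / (2 * lam) \<le> b / (2 * lam)\<close> by linarith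
    then show ?thesis using c by (simp add: field_simps)
  qed
  then have sm: "summable (\<lambda>k. \<beta> k * (norm (v k))\<^sup>2)"
    by (intro summableI_nonneg_bounded) (use assms(10) in \<open>auto simp: less_imp_le\<close>)
  define L where "L = (1 + 1 / d) / lam"
  have L: "L \<ge> 0" using d assms(5) by (simp add: L_def)
  have lip: "norm (v (Suc k)) \<le> norm (v k) + L * \<beta> k" for k
  proof -
    have "norm (v (Suc k) - v k) \<le> L * norm (x (Suc k) - x k)"
      using moreau_envelope_gradient_lipschitz[OF H] by (simp add: v_def F_def L_def d_def)
    also have "\<dots> \<le> L * \<beta> k" using len[of k] L by (intro mult_left_mono) (auto simp: assms(8))
    finally show ?thesis using norm_triangle_sub[of "v (Suc k)" "v k"] by linarith
  qed
  have "(\<lambda>k. sqrt ((\<beta> k)\<^sup>2)) \<longlonglongrightarrow> sqrt 0"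
    by (intro tendsto_real_sqrt summable_LIMSEQ_zero assms(12))
  then have b0: "\<beta> \<longlonglongrightarrow> 0" using assms(10) by (simp add: less_imp_le)
  have lim: "(\<lambda>k. norm (v k)) \<longlonglongrightarrow> 0"
    by (rule tendsto_zero_of_weighted_square_summable[OF _ assms(10,11) b0 sm L lip]) simp
  have acc: "stationary_point \<rho> f y" if r: "strict_mono r" and xr: "(x \<circ> r) \<longlonglongrightarrow> y" for y r
  proof -
    have vr: "(v \<circ> r) \<longlonglongrightarrow> 0"
      by (rule LIMSEQ_subseq_LIMSEQ[OF tendsto_norm_zero_cancel[OF lim] r])
    \<comment> \<open>Since \<open>v\<close> tends to 0, the proximal points share the limit
      \<open>y\<close>; the gradients are subgradients there, so 0 is a subgradient at
      \<open>y\<close>.\<close>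
    have "(\<lambda>n. (x \<circ> r) n - lam *\<^sub>R (v \<circ> r) n) \<longlonglongrightarrow> y - lam *\<^sub>R 0"
      by (intro tendsto_intros xr vr)
    moreover have "(v \<circ> r) n \<in> weak_subdifferential \<rho> f ((x \<circ> r) n - lam *\<^sub>R (v \<circ> r) n)" for n
      using moreau_envelope_gradient(2)[OF H] by (simp add: v_def F_def)
    ultimately show ?thesis unfolding stationary_point_def
      using weak_subdifferential_closed_graph[OF weakly_convex_continuous[OF assms(2)] _ _ vr]
      by fastforce
  qed
  show ?thesis
    unfolding Let_def F_def[symmetric] v_def[symmetric]
    using bd inD lim acc by auto
qed

end
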